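(* Let $f:[0,\infty)\to\mathbb R$ (no regularity assumed). The following conditions are equivalent: 1. For every $n\ge1$ and all $A,B\in\mathcal C_{\min,n}$, $A\preceq B$ implies $f[A]\preceq f[B]$. (Equivalently, for every $n\ge1$ and all $A,B\in\mathcal C_{\max,n}$, $A\preceq B$ implies $f[A]\preceq f[B]$.) 2. $f$ has increasing increments on $[0,\infty)$. 3. $f$ is nondecreasing and convex on $[0,\infty)$.
   Context: For $x=(x_1,\ldots,x_n)\in\mathbb R^n$, define the $n\times n$ real symmetric matrices $A_{\min}(x)=\bigl(x_{\min(i,j)}\bigr)_{i,j=1}^n$ and $A_{\max}(x)=\bigl(x_{\max(i,j)}\bigr)_{i,j=1}^n$. Set $\mathcal C_{\min,n}=\{A_{\min}(x):0\le x_1\le x_2\le\cdots\le x_n\}$ and $\mathcal C_{\max,n}=\{A_{\max}(x):x_1\ge x_2\ge\cdots\ge x_n\ge0\}$. For a matrix $A=(a_{ij})$ with entries in $[0,\infty)$, $f[A]=(f(a_{ij}))$. For real symmetric matrices, $A\preceq B$ means that $B-A$ is positive semidefinite (Loewner order). Set $G_f(s,d)=f(s+d)-f(s)$ for $s,d\ge0$. The function $f$ has increasing increments if $G_f$ is nondecreasing in each variable separately, i.e. $G_f(s,d)\le G_f(t,d)$ whenever $0\le s\le t$, $d\ge0$, and $G_f(s,d)\le G_f(s,e)$ whenever $s\ge0$, $0\le d\le e$; equivalently, $f(s+d)-f(s)\le f(t+e)-f(t)$ whenever $0\le s\le t$ and $0\le d\le e$. *)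

theory Defs
  imports "HOL-Analysis.Convex" "Jordan_Normal_Form.Matrix"
begin

text \<open>
  The indices of \<^typ>\<open>real vec\<close> and \<^typ>\<open>real mat\<close> run over \<open>{0..<n}\<close> instead of \<open>{1..n}\<close>.
  A function on the half-line \<open>{0..}\<close> is represented by a total function on the reals whose
  values at negative arguments are never used.
\<close>

definition A_min :: "real vec \<Rightarrow> real mat" where
  "A_min x = mat (dim_vec x) (dim_vec x) (\<lambda>(i, j). vec_index x (min i j))"

definition A_max :: "real vec \<Rightarrow> real mat" where
  "A_max x = mat (dim_vec x) (dim_vec x) (\<lambda>(i, j). vec_index x (max i j))"

definition C_min :: "nat \<Rightarrow> real mat set" where
  "C_min n = {A_min x | x. x \<in> carrier_vec n \<and> (\<forall>i<n. 0 \<le> vec_index x i) \<and>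
     (\<forall>i j. i \<le> j \<longrightarrow> j < n \<longrightarrow> vec_index x i \<le> vec_index x j)}"

definition C_max :: "nat \<Rightarrow> real mat set" where
  "C_max n = {A_max x | x. x \<in> carrier_vec n \<and> (\<forall>i<n. 0 \<le> vec_index x i) \<and>
     (\<forall>i j. i \<le> j \<longrightarrow> j < n \<longrightarrow> vec_index x j \<le> vec_index x i)}"

definition psd_mat :: "real mat \<Rightarrow> bool" where
  "psd_mat A \<longleftrightarrow> square_mat A \<and> transpose_mat A = A \<and>
     (\<forall>v \<in> carrier_vec (dim_row A). 0 \<le> scalar_prod v (A *\<^sub>v v))"

text \<open>
  The library's \<open>\<le>\<close> on matrices is the entrywise order, hence a separate symbol. The dimensions are compared explicitly because subtraction on
  \<^typ>\<open>real mat\<close> is total and takes the dimensions of its second argument.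
\<close>

definition loewner_le :: "real mat \<Rightarrow> real mat \<Rightarrow> bool" (infix \<open>\<preceq>\<^sub>L\<close> 50) where
  "A \<preceq>\<^sub>L B \<longleftrightarrow> dim_row A = dim_row B \<and> dim_col A = dim_col B \<and> psd_mat (B - A)"

definition increment :: "(real \<Rightarrow> real) \<Rightarrow> real \<Rightarrow> real \<Rightarrow> real" where
  "increment f s d = f (s + d) - f s"

definition increasing_increments :: "(real \<Rightarrow> real) \<Rightarrow> bool" where
  "increasing_increments f \<longleftrightarrow>
     (\<forall>s t d. 0 \<le> s \<longrightarrow> s \<le> t \<longrightarrow> 0 \<le> d \<longrightarrow> increment f s d \<le> increment f t d) \<and>
     (\<forall>s d e. 0 \<le> s \<longrightarrow> 0 \<le> d \<longrightarrow> d \<le> e \<longrightarrow> increment f s d \<le> increment f s e)"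

end

theory Submission
  imports Defs
begin

text \<open>
  Summation by parts diagonalises every matrix \<open>A_min x\<close>: its quadratic form at \<open>v\<close> is the
  sum over \<open>k\<close> of the consecutive difference \<open>x $ k - x $ (k - 1)\<close>, with \<open>x $ 0\<close> itself
  for \<open>k = 0\<close>, times the square of the tail sum of \<open>v\<close> from \<open>k\<close> on. The tail sums of \<open>v\<close> can be
  prescribed arbitrarily, so that \<open>A_min x\<close> lies below \<open>A_min y\<close> exactly when every consecutive
  difference of \<open>x\<close> is at most that of \<open>y\<close> (lemma \<open>loewner_le_A_min_iff\<close>). As \<open>f\<close> acts entrywise, it
  carries \<open>A_min x\<close> to \<open>A_min\<close> of the vector of values of \<open>f\<close>, and preservation of the order becomes a
  statement about increments of \<open>f\<close>: the vectors \<open>(s, s + d)\<close> and \<open>(t, t + e)\<close> already give the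
  inequality between two increments, and conversely that inequality, applied to each pair
  of neighbouring entries, handles every dimension. Reversing the order of the indices exchanges
  \<open>A_min\<close> and \<open>A_max\<close> and preserves the Loewner order, which settles the second form of the condition.

  For the link with convexity, the only delicate point is that no continuity is assumed.
  On an equidistant grid the increments of \<open>f\<close> are nondecreasing, which gives the chord inequality
  at rational ratios; since \<open>f\<close> is nondecreasing, a real ratio can be rounded up to a rational one, and
  the error vanishes as the grid is refined. In the other direction, \<open>s + d\<close> and \<open>t\<close> are convex
  combinations of \<open>s\<close> and \<open>t + d\<close> with the two weights interchanged.
\<close>

section \<open>Positive semidefiniteness as a condition on double sums\<close>

lemma psd_mat_iff_sum_nonneg:
  assumes A: "A \<in> carrier_mat n n"
  shows "psd_mat A \<longleftrightarrow> transpose_mat A = A \<and>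
    (\<forall>v :: nat \<Rightarrow> real. 0 \<le> (\<Sum>i<n. \<Sum>j<n. A $$ (i, j) * (v i * v j)))"
proof -
  have form: "scalar_prod v (A *\<^sub>v v) = (\<Sum>i<n. \<Sum>j<n. A $$ (i, j) * (v $ i * v $ j))"
    if "v \<in> carrier_vec n" for v
    using A that
    by (auto simp: scalar_prod_def lessThan_atLeast0 sum_distrib_left mult_ac intro!: sum.cong)
  have "(\<forall>v\<in>carrier_vec n. 0 \<le> scalar_prod v (A *\<^sub>v v)) \<longleftrightarrow>
    (\<forall>v :: nat \<Rightarrow> real. 0 \<le> (\<Sum>i<n. \<Sum>j<n. A $$ (i, j) * (v i * v j)))" (is "?L \<longleftrightarrow> ?R")
  proof
    assume L: ?L
    show ?R
    proof
      fix v :: "nat \<Rightarrow> real"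
      have "0 \<le> scalar_prod (vec n v) (A *\<^sub>v vec n v)"
        using L by simp
      then show "0 \<le> (\<Sum>i<n. \<Sum>j<n. A $$ (i, j) * (v i * v j))"
        by (simp add: form)
    qed
  qed (simp add: form)
  with A show ?thesis
    by (auto simp: psd_mat_def)
qed

section \<open>The Loewner order between matrices of minima\<close>

text \<open>Counting the entry before the first one as \<open>0\<close> lets the first entry be treated as a step
  like the others: a vector is nonnegative and nondecreasing if and only if all its steps
  are nonnegative.\<close>

definition vec_step :: "real vec \<Rightarrow> nat \<Rightarrow> real" where
  "vec_step x k = x $ k - (if k = 0 then 0 else x $ (k - 1))"

lemma sum_vec_step: "(\<Sum>k\<le>m. vec_step x k) = x $ m"
  by (induction m) (auto simp: vec_step_def)

lemma vec_step_minus: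
  assumes "x \<in> carrier_vec n" "y \<in> carrier_vec n" "k < n"
  shows "vec_step (y - x) k = vec_step y k - vec_step x k"
  using assms by (auto simp: vec_step_def)

lemma A_min_carrier: "x \<in> carrier_vec n \<Longrightarrow> A_min x \<in> carrier_mat n n"
  by (auto simp: A_min_def)

lemma A_min_minus:
  assumes "x \<in> carrier_vec n" "y \<in> carrier_vec n"
  shows "A_min y - A_min x = A_min (y - x)"
  using assms by (intro eq_matI) (auto simp: A_min_def min_def)

lemma map_mat_A_min: "map_mat f (A_min x) = A_min (map_vec f x)"
  by (intro eq_matI) (auto simp: A_min_def min_def)

text \<open>The entry at \<open>(i, j)\<close> is the sum of the steps up to \<open>min i j\<close>, so the \<open>k\<close>-th step contributes
  to exactly those entries with \<open>k \<le> i\<close> and \<open>k \<le> j\<close>: the all-ones block that starts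
  at \<open>k\<close>, whose quadratic form is the square of a tail sum.\<close>

lemma A_min_quadratic_form:
  assumes z: "z \<in> carrier_vec n"
  shows "(\<Sum>i<n. \<Sum>j<n. A_min z $$ (i, j) * (v i * v j)) =
    (\<Sum>k<n. vec_step z k * (\<Sum>i\<in>{k..<n}. v i)\<^sup>2)"
proof -
  let ?b = "\<lambda>k i. if k \<le> i then v i else 0"
  have entry: "A_min z $$ (i, j) * (v i * v j) = (\<Sum>k<n. vec_step z k * (?b k i * ?b k j))"
    if "i < n" "j < n" for i j
  proof -
    have "A_min z $$ (i, j) = (\<Sum>k\<le>min i j. vec_step z k)"
      using that z by (simp add: A_min_def sum_vec_step)
    then have "A_min z $$ (i, j) * (v i * v j) =
        (\<Sum>k\<le>min i j. vec_step z k * (v i * v j))"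
      by (simp add: sum_distrib_right)
    also have "\<dots> = (\<Sum>k<n. vec_step z k * (?b k i * ?b k j))"
      using that by (intro sum.mono_neutral_cong_left) auto
    finally show ?thesis .
  qed
  have "(\<Sum>i<n. \<Sum>j<n. A_min z $$ (i, j) * (v i * v j)) =
      (\<Sum>i<n. \<Sum>j<n. \<Sum>k<n. vec_step z k * (?b k i * ?b k j))"
    by (intro sum.cong refl entry) auto
  also have "\<dots> = (\<Sum>i<n. \<Sum>k<n. \<Sum>j<n. vec_step z k * (?b k i * ?b k j))"
    by (intro sum.cong refl sum.swap)
  also have "\<dots> = (\<Sum>k<n. \<Sum>i<n. \<Sum>j<n. vec_step z k * (?b k i * ?b k j))"
    by (rule sum.swap)
  also have "\<dots> = (\<Sum>k<n. vec_step z k * (\<Sum>i<n. ?b k i)\<^sup>2)"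
    unfolding power2_eq_square sum_product by (simp only: sum_distrib_left)
  also have "\<dots> = (\<Sum>k<n. vec_step z k * (\<Sum>i\<in>{k..<n}. v i)\<^sup>2)"
  proof (intro sum.cong refl)
    fix k
    have "(\<Sum>i<n. ?b k i) = (\<Sum>i\<in>{k..<n}. v i)"
      by (intro sum.mono_neutral_cong_right) auto
    then show "vec_step z k * (\<Sum>i<n. ?b k i)\<^sup>2 = vec_step z k * (\<Sum>i\<in>{k..<n}. v i)\<^sup>2"
      by simp
  qed
  finally show ?thesis .
qed

lemma psd_mat_A_min_iff:
  assumes z: "z \<in> carrier_vec n"
  shows "psd_mat (A_min z) \<longleftrightarrow> (\<forall>k<n. 0 \<le> vec_step z k)"
proof -
  have sym: "transpose_mat (A_min z) = A_min z"
    by (intro eq_matI) (auto simp: A_min_def min.commute)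
  have "psd_mat (A_min z) \<longleftrightarrow>
      (\<forall>v :: nat \<Rightarrow> real. 0 \<le> (\<Sum>k<n. vec_step z k * (\<Sum>i\<in>{k..<n}. v i)\<^sup>2))"
    using psd_mat_iff_sum_nonneg[OF A_min_carrier[OF z]] sym
    by (simp add: A_min_quadratic_form[OF z])
  also have "\<dots> \<longleftrightarrow> (\<forall>k<n. 0 \<le> vec_step z k)"
  proof (intro iffI allI impI)
    fix k
    assume nonneg: "\<forall>v :: nat \<Rightarrow> real. 0 \<le> (\<Sum>k<n. vec_step z k * (\<Sum>i\<in>{k..<n}. v i)\<^sup>2)"
      and k: "k < n"
    \<comment> \<open>The difference of two neighbouring unit vectors has a single nonzero tail sum, the one
      that starts at \<open>k\<close>; for \<open>k = 0\<close> the negative part is absent.\<close>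
    define v :: "nat \<Rightarrow> real"
      where "v i = (if i = k then 1 else 0) - (if Suc i = k then 1 else 0)" for i
    have tail: "(\<Sum>i\<in>{m..<n}. v i) = (if m = k then 1 else 0)" for m
    proof (cases k)
      case 0
      then show ?thesis
        using k by (simp add: v_def)
    next
      case (Suc k')
      then show ?thesis
        using k by (auto simp: v_def sum_subtractf)
    qed
    have "0 \<le> (\<Sum>m<n. vec_step z m * (\<Sum>i\<in>{m..<n}. v i)\<^sup>2)"
      using nonneg by blast
    also have "\<dots> = (\<Sum>m<n. if m = k then vec_step z m else 0)"
      by (intro sum.cong) (auto simp: tail)
    also have "\<dots> = vec_step z k"
      using k by simp
    finally show "0 \<le> vec_step z k" .
  qed (auto intro!: sum_nonneg)
  finally show ?thesis .
qed

lemma loewner_le_A_min_iff: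
  assumes "x \<in> carrier_vec n" "y \<in> carrier_vec n"
  shows "A_min x \<preceq>\<^sub>L A_min y \<longleftrightarrow> (\<forall>k<n. vec_step x k \<le> vec_step y k)"
proof -
  have "psd_mat (A_min y - A_min x) \<longleftrightarrow> (\<forall>k<n. 0 \<le> vec_step (y - x) k)"
    using assms by (simp add: A_min_minus psd_mat_A_min_iff[where n = n] minus_carrier_vec)
  then show ?thesis
    using assms A_min_carrier[OF assms(1)] A_min_carrier[OF assms(2)]
    by (simp add: loewner_le_def vec_step_minus[where n = n])
qed

section \<open>Reversal of the indices exchanges minima and maxima\<close>

definition reverse_mat :: "'a mat \<Rightarrow> 'a mat" where
  "reverse_mat A = mat (dim_row A) (dim_col A)
     (\<lambda>(i, j). A $$ (dim_row A - Suc i, dim_col A - Suc j))"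

lemma reverse_mat_carrier: "A \<in> carrier_mat n m \<Longrightarrow> reverse_mat A \<in> carrier_mat n m"
  by (auto simp: reverse_mat_def)

lemma reverse_mat_reverse_mat: "reverse_mat (reverse_mat A) = A"
  by (intro eq_matI) (auto simp: reverse_mat_def)

lemma reverse_mat_minus:
  assumes "A \<in> carrier_mat n m" "B \<in> carrier_mat n m"
  shows "reverse_mat B - reverse_mat A = reverse_mat (B - A)"
  using assms by (intro eq_matI) (auto simp: reverse_mat_def)

lemma map_mat_reverse_mat: "map_mat f (reverse_mat A) = reverse_mat (map_mat f A)"
  by (intro eq_matI) (auto simp: reverse_mat_def)

lemma psd_mat_reverse_mat:
  assumes psd: "psd_mat A"
  shows "psd_mat (reverse_mat A)"
proof -
  obtain n where A: "A \<in> carrier_mat n n"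
    using psd by (auto simp: psd_mat_def)
  have "transpose_mat A = A"
    using psd by (simp add: psd_mat_def)
  then have "A $$ (j, i) = A $$ (i, j)" if "i < n" "j < n" for i j
    using A that by (metis carrier_matD index_transpose_mat(1))
  then have sym: "transpose_mat (reverse_mat A) = reverse_mat A"
    using A by (intro eq_matI) (auto simp: reverse_mat_def)
  have "0 \<le> (\<Sum>i<n. \<Sum>j<n. reverse_mat A $$ (i, j) * (v i * v j))" for v :: "nat \<Rightarrow> real"
  proof -
    have "(\<Sum>i<n. \<Sum>j<n. reverse_mat A $$ (i, j) * (v i * v j)) =
        (\<Sum>i<n. \<Sum>j<n. reverse_mat A $$ (n - Suc i, n - Suc j) * (v (n - Suc i) * v (n - Suc j)))"
      by (simp only: sum.nat_diff_reindex[where g = "\<lambda>j. reverse_mat A $$ (_, j) * (_ * v j)"]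
          sum.nat_diff_reindex[where g = "\<lambda>i. \<Sum>j<n. reverse_mat A $$ (i, j) * (v i * v j)"])
    also have "\<dots> = (\<Sum>i<n. \<Sum>j<n. A $$ (i, j) * (v (n - Suc i) * v (n - Suc j)))"
      using A by (intro sum.cong refl) (auto simp: reverse_mat_def)
    also have "\<dots> \<ge> 0"
      using psd psd_mat_iff_sum_nonneg[OF A] by (auto dest: spec[where x = "\<lambda>i. v (n - Suc i)"])
    finally show ?thesis .
  qed
  then show ?thesis
    using sym psd_mat_iff_sum_nonneg[OF reverse_mat_carrier[OF A]] by blast
qed

lemma loewner_le_reverse_mat_iff: "reverse_mat A \<preceq>\<^sub>L reverse_mat B \<longleftrightarrow> A \<preceq>\<^sub>L B"
proof -
  have imp: "reverse_mat A \<preceq>\<^sub>L reverse_mat B" if le: "A \<preceq>\<^sub>L B" for A B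
  proof -
    have carrier: "A \<in> carrier_mat (dim_row B) (dim_col B)" "B \<in> carrier_mat (dim_row B) (dim_col B)"
      using le unfolding loewner_le_def by blast+
    have "psd_mat (reverse_mat B - reverse_mat A)"
      unfolding reverse_mat_minus[OF carrier]
      using le unfolding loewner_le_def by (blast intro: psd_mat_reverse_mat)
    then show ?thesis
      using reverse_mat_carrier[OF carrier(1)] reverse_mat_carrier[OF carrier(2)]
      unfolding loewner_le_def by (metis carrier_matD)
  qed
  show ?thesis
    using imp[of A B] imp[of "reverse_mat A" "reverse_mat B"]
    unfolding reverse_mat_reverse_mat by blast
qed

lemma min_diff_Suc: "min (n - Suc i) (n - Suc j) = n - Suc (max i j)"
  and max_diff_Suc: "max (n - Suc i) (n - Suc j) = n - Suc (min i j)"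
  by auto

lemma reverse_mat_A_min:
  "reverse_mat (A_min x) = A_max (vec (dim_vec x) (\<lambda>i. x $ (dim_vec x - Suc i)))"
  by (intro eq_matI) (auto simp: reverse_mat_def A_min_def A_max_def min_diff_Suc max_diff_Suc)

lemma reverse_mat_A_max:
  "reverse_mat (A_max x) = A_min (vec (dim_vec x) (\<lambda>i. x $ (dim_vec x - Suc i)))"
  by (intro eq_matI) (auto simp: reverse_mat_def A_min_def A_max_def min_diff_Suc max_diff_Suc)

lemma C_max_eq_reverse_C_min: "C_max n = reverse_mat ` C_min n"
proof -
  have to_max: "reverse_mat A \<in> C_max n" if A: "A \<in> C_min n" for A
  proof -
    obtain x where x: "A = A_min x" "x \<in> carrier_vec n" "\<And>i. i < n \<Longrightarrow> 0 \<le> x $ i"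
        "\<And>i j. i \<le> j \<Longrightarrow> j < n \<Longrightarrow> x $ i \<le> x $ j"
      using A by (auto simp: C_min_def)
    then show ?thesis
      unfolding C_max_def
      by (intro CollectI exI[of _ "vec n (\<lambda>i. x $ (n - Suc i))"]) (auto simp: reverse_mat_A_min)
  qed
  have to_min: "reverse_mat A \<in> C_min n" if A: "A \<in> C_max n" for A
  proof -
    obtain x where x: "A = A_max x" "x \<in> carrier_vec n" "\<And>i. i < n \<Longrightarrow> 0 \<le> x $ i"
        "\<And>i j. i \<le> j \<Longrightarrow> j < n \<Longrightarrow> x $ j \<le> x $ i"
      using A by (auto simp: C_max_def)
    then show ?thesis
      unfolding C_min_def
      by (intro CollectI exI[of _ "vec n (\<lambda>i. x $ (n - Suc i))"]) (auto simp: reverse_mat_A_max)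
  qed
  show ?thesis
  proof
    show "C_max n \<subseteq> reverse_mat ` C_min n"
    proof
      fix A assume "A \<in> C_max n"
      then show "A \<in> reverse_mat ` C_min n"
        by (intro image_eqI[where x = "reverse_mat A"] to_min)
          (simp_all add: reverse_mat_reverse_mat)
    qed
    show "reverse_mat ` C_min n \<subseteq> C_max n"
      by (rule image_subsetI) (rule to_max)
  qed
qed

lemma preserves_loewner_C_max_iff_C_min:
  "(\<forall>A \<in> C_max n. \<forall>B \<in> C_max n. A \<preceq>\<^sub>L B \<longrightarrow> map_mat f A \<preceq>\<^sub>L map_mat f B) \<longleftrightarrow>
   (\<forall>A \<in> C_min n. \<forall>B \<in> C_min n. A \<preceq>\<^sub>L B \<longrightarrow> map_mat f A \<preceq>\<^sub>L map_mat f B)"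
  by (simp add: C_max_eq_reverse_C_min map_mat_reverse_mat loewner_le_reverse_mat_iff)

section \<open>Preservation of the Loewner order and increasing increments\<close>

lemma increasing_increments_imp_mono_on:
  assumes "increasing_increments f"
  shows "mono_on {0..} f"
proof (rule mono_onI)
  fix r s :: real
  assume "r \<in> {0..}" "r \<le> s"
  then have "increment f r 0 \<le> increment f r (s - r)"
    using assms unfolding increasing_increments_def by simp
  then show "f r \<le> f s"
    by (simp add: increment_def)
qed

lemma increasing_increments_joint:
  assumes "increasing_increments f" "0 \<le> s" "s \<le> t" "0 \<le> d" "d \<le> e"
  shows "increment f s d \<le> increment f t e"
proof -
  have "increment f s d \<le> increment f t d" "increment f t d \<le> increment f t e"
    using assms unfolding increasing_increments_def by auto
  then show ?thesis
    by simp
qed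

lemma increasing_increments_imp_preserves_loewner:
  assumes f: "increasing_increments f"
    and A: "A \<in> C_min n" and B: "B \<in> C_min n" and le: "A \<preceq>\<^sub>L B"
  shows "map_mat f A \<preceq>\<^sub>L map_mat f B"
proof -
  obtain x where x: "A = A_min x" "x \<in> carrier_vec n" "\<And>i. i < n \<Longrightarrow> 0 \<le> x $ i"
      "\<And>i j. i \<le> j \<Longrightarrow> j < n \<Longrightarrow> x $ i \<le> x $ j"
    using A by (auto simp: C_min_def)
  obtain y where y: "B = A_min y" "y \<in> carrier_vec n" "\<And>i. i < n \<Longrightarrow> 0 \<le> y $ i"
      "\<And>i j. i \<le> j \<Longrightarrow> j < n \<Longrightarrow> y $ i \<le> y $ j"
    using B by (auto simp: C_min_def)
  have step: "vec_step x k \<le> vec_step y k" if "k < n" for k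
    using le that x(2) y(2) by (simp add: x(1) y(1) loewner_le_A_min_iff)
  have entry: "x $ k \<le> y $ k" if "k < n" for k
  proof -
    have "(\<Sum>i\<le>k. vec_step x i) \<le> (\<Sum>i\<le>k. vec_step y i)"
      using that by (intro sum_mono step) auto
    then show ?thesis
      by (simp add: sum_vec_step)
  qed
  have "vec_step (map_vec f x) k \<le> vec_step (map_vec f y) k" if k: "k < n" for k
  proof (cases k)
    case 0
    have "f (x $ 0) \<le> f (y $ 0)"
      using increasing_increments_imp_mono_on[OF f] entry[of 0] x(3)[of 0] y(3)[of 0] k 0
      by (auto simp: mono_on_def)
    then show ?thesis
      using 0 k x(2) y(2) by (simp add: vec_step_def)
  next
    case (Suc m)
    have "increment f (x $ m) (x $ Suc m - x $ m) \<le> increment f (y $ m) (y $ Suc m - y $ m)"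
      using k Suc step[of k] entry[of m] x(3)[of m] x(4)[of m "Suc m"]
      by (intro increasing_increments_joint[OF f]) (auto simp: vec_step_def)
    then show ?thesis
      using Suc k x(2) y(2) by (simp add: vec_step_def increment_def)
  qed
  then show ?thesis
    using x(2) y(2) by (simp add: x(1) y(1) map_mat_A_min loewner_le_A_min_iff[where n = n])
qed

text \<open>Size two is enough to compare arbitrary increments: the two steps of \<open>(s, s + d)\<close>
  are \<open>s\<close> and \<open>d\<close>.\<close>

lemma preserves_loewner_2_imp_increments:
  assumes pres: "\<And>A B. A \<in> C_min 2 \<Longrightarrow> B \<in> C_min 2 \<Longrightarrow> A \<preceq>\<^sub>L B \<Longrightarrow> map_mat f A \<preceq>\<^sub>L map_mat f B"
    and st: "0 \<le> s" "s \<le> t" and de: "0 \<le> d" "d \<le> e"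
  shows "increment f s d \<le> increment f t e"
proof -
  define p where "p a b = vec 2 (\<lambda>i. if i = 0 then a else a + b)" for a b :: real
  have carrier: "p a b \<in> carrier_vec 2" for a b
    by (simp add: p_def)
  have mem: "A_min (p a b) \<in> C_min 2" if "0 \<le> a" "0 \<le> b" for a b
    using that unfolding C_min_def by (intro CollectI exI[of _ "p a b"]) (auto simp: p_def)
  have "A_min (p s d) \<preceq>\<^sub>L A_min (p t e)"
    unfolding loewner_le_A_min_iff[OF carrier carrier]
    using st de by (auto simp: vec_step_def p_def)
  then have "A_min (map_vec f (p s d)) \<preceq>\<^sub>L A_min (map_vec f (p t e))"
    using pres[OF mem mem] st de by (simp add: map_mat_A_min)
  then have "vec_step (map_vec f (p s d)) 1 \<le> vec_step (map_vec f (p t e)) 1"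
    using carrier by (subst (asm) loewner_le_A_min_iff[where n = 2]) auto
  then show ?thesis
    by (simp add: vec_step_def p_def increment_def)
qed

lemma preserves_loewner_iff_increasing_increments:
  "(\<forall>n\<ge>1. \<forall>A \<in> C_min n. \<forall>B \<in> C_min n. A \<preceq>\<^sub>L B \<longrightarrow> map_mat f A \<preceq>\<^sub>L map_mat f B) \<longleftrightarrow>
    increasing_increments f" (is "?P \<longleftrightarrow> _")
proof
  assume ?P
  then have "map_mat f A \<preceq>\<^sub>L map_mat f B" if "A \<in> C_min 2" "B \<in> C_min 2" "A \<preceq>\<^sub>L B" for A B
    using that by (meson one_le_numeral)
  then show "increasing_increments f"
    unfolding increasing_increments_def by (auto intro: preserves_loewner_2_imp_increments)
qed (auto intro: increasing_increments_imp_preserves_loewner)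

section \<open>Increasing increments and convexity\<close>

text \<open>The increment \<open>g (Suc k) - g k\<close> bounds the earlier increments from above and the later ones from
  below, so it separates the average slope of \<open>g\<close> before \<open>k\<close> from the one after \<open>k\<close>.\<close>

lemma chord_inequality_of_increasing_differences:
  fixes g :: "nat \<Rightarrow> real"
  assumes inc: "\<And>i j. i \<le> j \<Longrightarrow> g (Suc i) - g i \<le> g (Suc j) - g j"
    and k: "k \<le> n"
  shows "n * (g k - g 0) \<le> k * (g n - g 0)"
proof -
  define D where "D = g (Suc k) - g k"
  have "g k - g 0 = (\<Sum>i<k. g (Suc i) - g i)"
    by (simp add: sum_lessThan_telescope)
  also have "\<dots> \<le> (\<Sum>i<k. D)"
    unfolding D_def by (intro sum_mono inc) auto
  finally have before: "g k - g 0 \<le> k * D"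
    by simp
  have "real (n - k) * D = (\<Sum>i\<in>{k..<n}. D)"
    by simp
  also have "\<dots> \<le> (\<Sum>i\<in>{k..<n}. g (Suc i) - g i)"
    unfolding D_def by (intro sum_mono inc) auto
  also have "\<dots> = g n - g k"
    using k by (simp add: sum_Suc_diff')
  finally have after: "real (n - k) * D \<le> g n - g k" .
  have "real (n - k) * (g k - g 0) \<le> real (n - k) * (k * D)"
    using before by (intro mult_left_mono) auto
  also have "\<dots> = k * (real (n - k) * D)"
    by simp
  also have "\<dots> \<le> k * (g n - g k)"
    using after by (intro mult_left_mono) auto
  finally show ?thesis
    using k by (simp add: of_nat_diff algebra_simps)
qed

lemma increasing_increments_imp_convex_on:
  assumes f: "increasing_increments f"
  shows "convex_on {0..} f"
proof (rule convex_on_linorderI)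
  fix t x y :: real
  assume t: "0 < t" "t < 1" and xy: "x \<in> {0..}" "y \<in> {0..}" "x < y"
  define z where "z = (1 - t) * x + t * y"
  have x0: "0 \<le> x"
    using xy by simp
  have mono: "f a \<le> f b" if "0 \<le> a" "a \<le> b" for a b
    using increasing_increments_imp_mono_on[OF f] that by (auto simp: mono_on_def)
  have approx: "f z - f x - t * (f y - f x) \<le> (f y - f x) / n" if n: "0 < n" for n :: nat
  proof -
    define h where "h = (y - x) / n"
    define k where "k = nat \<lceil>t * n\<rceil>"
    define g where "g i = f (x + real i * h)" for i :: nat
    have h: "0 \<le> h"
      using xy by (simp add: h_def)
    have nh: "n * h = y - x"
      using n by (simp add: h_def)
    have tn: "0 < t * n" "t * n \<le> n"
      using t n by (auto simp: mult_le_cancel_right1)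
    have kn: "k \<le> n"
      using tn by (simp add: k_def nat_le_iff ceiling_le_iff)
    have k: "t * n \<le> k" "k \<le> t * n + 1"
      using tn unfolding k_def by linarith+
    have inc: "g (Suc i) - g i \<le> g (Suc j) - g j" if "i \<le> j" for i j
    proof -
      have "real i * h \<le> real j * h"
        using that h by (simp add: mult_right_mono)
      then show ?thesis
        using increasing_increments_joint[OF f, of "x + i * h" "x + j * h" h h] h x0
        by (simp add: g_def increment_def algebra_simps)
    qed
    \<comment> \<open>The grid point with index \<open>k\<close> is the first one that is not below \<open>z\<close>.\<close>
    have "z = x + t * (y - x)"
      by (simp add: z_def algebra_simps)
    also have "\<dots> = x + (t * n) * h"
      by (simp flip: nh)
    also have "\<dots> \<le> x + k * h"
      using k h by (simp add: mult_right_mono)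
    finally have "f z \<le> g k"
      unfolding g_def using t xy by (intro mono) (auto simp: z_def)
    then have "n * (f z - f x) \<le> n * (g k - g 0)"
      by (simp add: g_def mult_left_mono)
    also have "\<dots> \<le> k * (g n - g 0)"
      using inc kn by (rule chord_inequality_of_increasing_differences)
    also have "g n - g 0 = f y - f x"
      by (simp add: g_def nh)
    also have "k * (f y - f x) \<le> (t * n + 1) * (f y - f x)"
      using k mono[of x y] x0 xy by (intro mult_right_mono) auto
    finally show ?thesis
      using n by (simp add: field_simps)
  qed
  have "f z - f x - t * (f y - f x) \<le> 0"
  proof (rule LIMSEQ_le_const)
    show "(\<lambda>n. (f y - f x) / real n) \<longlonglongrightarrow> 0"
      by (rule lim_const_over_n)
    show "\<exists>N. \<forall>n\<ge>N. f z - f x - t * (f y - f x) \<le> (f y - f x) / real n"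
      using approx by (intro exI[of _ 1]) auto
  qed
  then show "f ((1 - t) *\<^sub>R x + t *\<^sub>R y) \<le> (1 - t) * f x + t * f y"
    by (simp add: z_def algebra_simps)
qed simp

lemma convex_on_imp_increment_mono:
  assumes f: "convex_on {0..} f" and st: "0 \<le> s" "s \<le> t" and d: "0 \<le> d"
  shows "increment f s d \<le> increment f t d"
proof (cases "t + d - s = 0")
  case True
  then have "s = t"
    using st d by linarith
  then show ?thesis
    by simp
next
  case False
  define u where "u = d / (t + d - s)"
  have len: "0 < t + d - s"
    using False st d by linarith
  have u: "0 \<le> u" "u \<le> 1"
    using st d len by (auto simp: u_def)
  have ud: "u * (t + d - s) = d"
    using False by (simp add: u_def)
  have "s + d = (1 - u) *\<^sub>R s + u *\<^sub>R (t + d)"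
    using ud by (simp add: algebra_simps)
  moreover have "t = (1 - (1 - u)) *\<^sub>R s + (1 - u) *\<^sub>R (t + d)"
    using ud by (simp add: algebra_simps)
  ultimately have "f (s + d) \<le> (1 - u) * f s + u * f (t + d)"
    and "f t \<le> (1 - (1 - u)) * f s + (1 - u) * f (t + d)"
    using convex_onD[OF f, of u s "t + d"] convex_onD[OF f, of "1 - u" s "t + d"] u st d
    by auto
  then show ?thesis
    by (simp add: increment_def algebra_simps)
qed

lemma increasing_increments_iff_mono_convex:
  "increasing_increments f \<longleftrightarrow> mono_on {0..} f \<and> convex_on {0..} f"
proof
  assume "mono_on {0..} f \<and> convex_on {0..} f"
  then show "increasing_increments f"
    unfolding increasing_increments_def
    by (auto intro: convex_on_imp_increment_mono) (simp add: increment_def mono_on_def)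
qed (simp add: increasing_increments_imp_mono_on increasing_increments_imp_convex_on)

section \<open>The equivalence\<close>

theorem theorem5p2:
  fixes f :: "real \<Rightarrow> real"
  shows
    "((\<forall>n\<ge>1. \<forall>A \<in> C_min n. \<forall>B \<in> C_min n. A \<preceq>\<^sub>L B \<longrightarrow> map_mat f A \<preceq>\<^sub>L map_mat f B)
        \<longleftrightarrow> (\<forall>n\<ge>1. \<forall>A \<in> C_max n. \<forall>B \<in> C_max n. A \<preceq>\<^sub>L B \<longrightarrow> map_mat f A \<preceq>\<^sub>L map_mat f B)) \<and>
     ((\<forall>n\<ge>1. \<forall>A \<in> C_min n. \<forall>B \<in> C_min n. A \<preceq>\<^sub>L B \<longrightarrow> map_mat f A \<preceq>\<^sub>L map_mat f B)
        \<longleftrightarrow> increasing_increments f) \<and>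
     (increasing_increments f \<longleftrightarrow> mono_on {0..} f \<and> convex_on {0..} f)"
  unfolding preserves_loewner_C_max_iff_C_min preserves_loewner_iff_increasing_increments
    increasing_increments_iff_mono_convex
  by blast

end
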